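(* Let $\mathbf{C}$ be a topological category and let $F:\mathbf{C}\to\mathbf{T}$ be a monomorphic functor with finite supports. Let $X$ be an object of $\mathbf{C}$. For any element $a\in F^\circ X$ the support $A=\mathrm{supp}_X(a)$ is a well-defined finite subset of $X$ (that is, the family of sets whose intersection defines it is non-empty) such that $a\in F^\circ i^A_X(F^\circ A)$.
   Context: $\mathbf{T}$ is the category whose objects are topological spaces and whose morphisms are all (not necessarily continuous) functions between topological spaces. A topological category is a subcategory $\mathbf{C}$ of $\mathbf{T}$ such that each finite discrete topological space (including $\emptyset$) is an object of $\mathbf{C}$ and each map $f:D\to X$ from a finite discrete space $D$ to an object $X$ of $\mathbf{C}$ is a morphism of $\mathbf{C}$. A functor $F:\mathbf{C}\to\mathbf{T}$ is monomorphic if it preserves monomorphisms. It has finite supports if for each object $X$ of $\mathbf{C}$ and each $a\in FX$ there is a map $f:A\to X$ from a finite discrete space $A$ such that $a\in Ff(FA)$. A finite ordinal $n$ is identified with the finite discrete space $\{0,\dots,n-1\}$. The maximal $\emptyset$-modification $F^\circ:\mathbf{C}\to\mathbf{T}$ of a monomorphic functor $F$ is the monomorphic functor defined as follows. On objects: $F^\circ X=FX$ for non-empty $X$, and $F^\circ\emptyset=\{a\in F1: Ff_0(a)=Ff_1(a)\}\subset F1$, where $f_i:1\to 2$ is the constant map with value $i$. On a morphism $f:X\to Y$: $F^\circ f=Ff$ if $X\neq\emptyset$; $F^\circ f$ is the identity of $F^\circ\emptyset$ if $X=Y=\emptyset$; and if $X=\emptyset\ne Y$, then $F^\circ f=Fg|_{F^\circ\emptyset}:F^\circ\emptyset\to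 FY$, where $g:1\to Y$ is any map (the result does not depend on $g$). Each finite subset $A\subset X$ is endowed with the discrete topology, and $i^A_X:A\to X$, $x\mapsto x$, denotes the inclusion map. $[X]^{<\omega}$ is the set of finite subsets of $X$. For $a\in F^\circ X$ the support of $a$ is $$\mathrm{supp}_X(a)=\bigcap\{A\in[X]^{<\omega}: a\in F^\circ i^A_X(F^\circ A)\}.$$ *)

theory Defs
  imports "HOL-Analysis.Abstract_Topology" "HOL-Library.FuncSet"
begin

text \<open>
  Spaces are values of type \<^typ>\<open>'a topology\<close>, so the points of all objects of a category are drawn
  from one type. Maps between spaces are extensional functions (undefined outside the domain), so
  that equality of maps is equality in HOL. Composition and identities are always those of sets
  and maps; a category of spaces is therefore given by its objects and its hom-sets.
\<close>

record 'a spacecat =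
  Ob :: "'a topology set"
  Hom :: "'a topology \<Rightarrow> 'a topology \<Rightarrow> ('a \<Rightarrow> 'a) set"

definition maps :: "'a topology \<Rightarrow> 'b topology \<Rightarrow> ('a \<Rightarrow> 'b) set" where
  "maps X Y = topspace X \<rightarrow>\<^sub>E topspace Y"

definition id_map :: "'a topology \<Rightarrow> 'a \<Rightarrow> 'a" where
  "id_map X = (\<lambda>x\<in>topspace X. x)"

definition all_maps_cat :: "'a spacecat" where
  "all_maps_cat = \<lparr>Ob = UNIV, Hom = maps\<rparr>"

definition subcategory :: "'a spacecat \<Rightarrow> 'a spacecat \<Rightarrow> bool" where
  "subcategory C D \<longleftrightarrow>
     Ob C \<subseteq> Ob D \<and>
     (\<forall>X\<in>Ob C. \<forall>Y\<in>Ob C. Hom C X Y \<subseteq> Hom D X Y) \<and>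
     (\<forall>X\<in>Ob C. id_map X \<in> Hom C X X) \<and>
     (\<forall>X\<in>Ob C. \<forall>Y\<in>Ob C. \<forall>Z\<in>Ob C. \<forall>f\<in>Hom C X Y. \<forall>g\<in>Hom C Y Z.
        compose (topspace X) g f \<in> Hom C X Z)"

definition topological_category :: "'a spacecat \<Rightarrow> bool" where
  "topological_category C \<longleftrightarrow>
     subcategory C all_maps_cat \<and>
     (\<forall>D. finite D \<longrightarrow> discrete_topology D \<in> Ob C) \<and>
     (\<forall>D. \<forall>X\<in>Ob C. finite D \<longrightarrow> maps (discrete_topology D) X \<subseteq> Hom C (discrete_topology D) X)"

definition monomorphism ::
    "'a spacecat \<Rightarrow> 'a topology \<Rightarrow> 'a topology \<Rightarrow> ('a \<Rightarrow> 'a) \<Rightarrow> bool" where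
  "monomorphism C X Y f \<longleftrightarrow>
     X \<in> Ob C \<and> Y \<in> Ob C \<and> f \<in> Hom C X Y \<and>
     (\<forall>Z\<in>Ob C. \<forall>g\<in>Hom C Z X. \<forall>h\<in>Hom C Z X.
        compose (topspace Z) f g = compose (topspace Z) f h \<longrightarrow> g = h)"

text \<open>
  The action on morphisms takes the domain and the codomain as arguments, since the same
  extensional function is a different morphism for a different codomain or a different topology.
\<close>

record ('a, 'b) spacefun =
  FOb :: "'a topology \<Rightarrow> 'b topology"
  FMap :: "'a topology \<Rightarrow> 'a topology \<Rightarrow> ('a \<Rightarrow> 'a) \<Rightarrow> ('b \<Rightarrow> 'b)"

definition is_functor :: "'a spacecat \<Rightarrow> 'b spacecat \<Rightarrow> ('a, 'b) spacefun \<Rightarrow> bool" where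
  "is_functor C D F \<longleftrightarrow>
     (\<forall>X\<in>Ob C. FOb F X \<in> Ob D) \<and>
     (\<forall>X\<in>Ob C. \<forall>Y\<in>Ob C. \<forall>f\<in>Hom C X Y. FMap F X Y f \<in> Hom D (FOb F X) (FOb F Y)) \<and>
     (\<forall>X\<in>Ob C. FMap F X X (id_map X) = id_map (FOb F X)) \<and>
     (\<forall>X\<in>Ob C. \<forall>Y\<in>Ob C. \<forall>Z\<in>Ob C. \<forall>f\<in>Hom C X Y. \<forall>g\<in>Hom C Y Z.
        FMap F X Z (compose (topspace X) g f) =
        compose (topspace (FOb F X)) (FMap F Y Z g) (FMap F X Y f))"

definition monomorphic :: "'a spacecat \<Rightarrow> 'b spacecat \<Rightarrow> ('a, 'b) spacefun \<Rightarrow> bool" where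
  "monomorphic C D F \<longleftrightarrow>
     (\<forall>X Y f. monomorphism C X Y f \<longrightarrow> monomorphism D (FOb F X) (FOb F Y) (FMap F X Y f))"

definition finite_supports :: "'a spacecat \<Rightarrow> ('a, 'b) spacefun \<Rightarrow> bool" where
  "finite_supports C F \<longleftrightarrow>
     (\<forall>X\<in>Ob C. \<forall>a\<in>topspace (FOb F X).
        \<exists>A. finite A \<and>
          (\<exists>f\<in>maps (discrete_topology A) X.
             a \<in> FMap F (discrete_topology A) X f ` topspace (FOb F (discrete_topology A))))"

text \<open>
  An injection \<open>\<nu>\<close> of the natural numbers into the type of points says which points represent
  the finite ordinals.
\<close>

definition ordinal_space :: "(nat \<Rightarrow> 'a) \<Rightarrow> nat \<Rightarrow> 'a topology" where
  "ordinal_space \<nu> n = discrete_topology (\<nu> ` {..<n})"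

definition const_1_2 :: "(nat \<Rightarrow> 'a) \<Rightarrow> nat \<Rightarrow> 'a \<Rightarrow> 'a" where
  "const_1_2 \<nu> i = (\<lambda>x\<in>topspace (ordinal_space \<nu> 1). \<nu> i)"

definition circ_empty :: "(nat \<Rightarrow> 'a) \<Rightarrow> ('a, 'b) spacefun \<Rightarrow> 'b set" where
  "circ_empty \<nu> F =
     {a \<in> topspace (FOb F (ordinal_space \<nu> 1)).
        FMap F (ordinal_space \<nu> 1) (ordinal_space \<nu> 2) (const_1_2 \<nu> 0) a =
        FMap F (ordinal_space \<nu> 1) (ordinal_space \<nu> 2) (const_1_2 \<nu> 1) a}"

text \<open>
  The maximal modification at the empty space. The choice of \<open>g\<close> does not matter,
  see \<open>circ_empty_eq\<close> below.
\<close>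

definition circ :: "(nat \<Rightarrow> 'a) \<Rightarrow> ('a, 'b) spacefun \<Rightarrow> ('a, 'b) spacefun" where
  "circ \<nu> F = \<lparr>
     FOb = (\<lambda>X. if topspace X \<noteq> {} then FOb F X
                else subtopology (FOb F (ordinal_space \<nu> 1)) (circ_empty \<nu> F)),
     FMap = (\<lambda>X Y f.
        if topspace X \<noteq> {} then FMap F X Y f
        else if topspace Y = {} then (\<lambda>a\<in>circ_empty \<nu> F. a)
        else (\<lambda>a\<in>circ_empty \<nu> F.
                FMap F (ordinal_space \<nu> 1) Y (SOME g. g \<in> maps (ordinal_space \<nu> 1) Y) a))\<rparr>"

lemma circ_empty_eq:
  assumes C: "topological_category C" and F: "is_functor C all_maps_cat F" and \<nu>: "inj \<nu>"
    and Y: "Y \<in> Ob C" and a: "a \<in> circ_empty \<nu> F"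
    and g: "g \<in> maps (ordinal_space \<nu> 1) Y" "g' \<in> maps (ordinal_space \<nu> 1) Y"
  shows "FMap F (ordinal_space \<nu> 1) Y g a = FMap F (ordinal_space \<nu> 1) Y g' a"
proof -
  let ?P = "ordinal_space \<nu> 1" and ?Q = "ordinal_space \<nu> 2"
  have ne: "\<nu> 1 \<noteq> \<nu> 0" using \<nu> by (auto dest: injD)
  have tP: "topspace ?P = {\<nu> 0}" and tQ: "topspace ?Q = {\<nu> 0, \<nu> 1}"
    by (auto simp: ordinal_space_def lessThan_Suc numeral_2_eq_2)
  have ob: "?P \<in> Ob C" "?Q \<in> Ob C"
    and hom: "maps ?P ?Q \<subseteq> Hom C ?P ?Q" "maps ?Q Y \<subseteq> Hom C ?Q Y"
    using C Y by (auto simp: topological_category_def ordinal_space_def)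
  define h where "h = (\<lambda>x\<in>topspace ?Q. if x = \<nu> 0 then g (\<nu> 0) else g' (\<nu> 0))"
  have h: "h \<in> Hom C ?Q Y"
    using g by (auto simp: h_def maps_def tP tQ simp del: One_nat_def
        intro!: subsetD[OF hom(2)])
  have c: "const_1_2 \<nu> i \<in> Hom C ?P ?Q" if "i < 2" for i
  proof -
    have "i = 0 \<or> i = 1" using that by linarith
    then show ?thesis
      by (auto simp: const_1_2_def maps_def tP tQ simp del: One_nat_def
          intro!: subsetD[OF hom(1)])
  qed
  have "g = compose (topspace ?P) h (const_1_2 \<nu> 0)" "g' = compose (topspace ?P) h (const_1_2 \<nu> 1)"
    using g ne unfolding maps_def
    by (auto simp: compose_def const_1_2_def h_def tP tQ fun_eq_iff PiE_def extensional_def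
        simp del: One_nat_def)
  moreover have "FMap F ?P Y (compose (topspace ?P) h (const_1_2 \<nu> i)) =
      compose (topspace (FOb F ?P)) (FMap F ?Q Y h) (FMap F ?P ?Q (const_1_2 \<nu> i))" if "i < 2" for i
    using F ob Y h c[OF that] unfolding is_functor_def by blast
  ultimately show ?thesis
    using a by (simp add: circ_empty_def compose_eq del: One_nat_def)
qed

definition supporting_sets ::
    "(nat \<Rightarrow> 'a) \<Rightarrow> ('a, 'b) spacefun \<Rightarrow> 'a topology \<Rightarrow> 'b \<Rightarrow> 'a set set" where
  "supporting_sets \<nu> F X a =
     {A. finite A \<and> A \<subseteq> topspace X \<and>
         a \<in> FMap (circ \<nu> F) (discrete_topology A) X (\<lambda>x\<in>A. x) `
               topspace (FOb (circ \<nu> F) (discrete_topology A))}"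

text \<open>
  The intersection of an empty family is \<^term>\<open>UNIV\<close> here, so the support is meaningful only if
  \<^const>\<open>supporting_sets\<close> is non-empty.
\<close>

definition supp ::
    "(nat \<Rightarrow> 'a) \<Rightarrow> ('a, 'b) spacefun \<Rightarrow> 'a topology \<Rightarrow> 'b \<Rightarrow> 'a set" where
  "supp \<nu> F X a = \<Inter> (supporting_sets \<nu> F X a)"

end

theory Submission imports Defs begin

text \<open>
  Say that a finite set \<open>A\<close> of points of \<open>X\<close> carries an element \<open>a\<close> of \<open>F X\<close> if \<open>a\<close> lies in the image
  of \<open>F\<close> applied to the inclusion of \<open>A\<close>. A family of finite sets that is non-empty and closed under
  binary intersections contains its own intersection: a member of least cardinality lies in all the
  others. Hence it suffices that some set carries \<open>a\<close>, which is what finite supports give, and that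
  for the modified functor the intersection of two carriers \<open>A\<close> and \<open>B\<close> is again a carrier.

  The category may have no interesting morphisms out of \<open>X\<close>, so the second point is moved to the
  finite discrete space \<open>E = A \<union> B\<close>, on which all maps are morphisms. The inclusion of \<open>E\<close> into \<open>X\<close> is
  a monomorphism, so \<open>F\<close> sends it to an injection, and \<open>a\<close> is the image of a single \<open>e\<close> in \<open>F E\<close>
  which is carried both by \<open>A\<close> and by \<open>B\<close> (lemma \<open>lift_to_union\<close>). On an element carried by \<open>A\<close>,
  maps that agree on \<open>A\<close> act in the same way (lemma \<open>FMap_cong_on_carrier\<close>).

  If \<open>A\<close> and \<open>B\<close> have a common point \<open>d\<close>, let \<open>u\<close> be the map of \<open>E\<close> to itself that fixes \<open>A\<close> and sends
  the rest of \<open>B\<close> to \<open>d\<close>. It fixes \<open>e\<close>, because it is the identity on \<open>A\<close>, and it maps \<open>B\<close> into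
  \<open>A \<inter> B\<close>, so \<open>e\<close> is carried by \<open>A \<inter> B\<close> (lemma \<open>carrier_Int\<close>).

  If \<open>A\<close> and \<open>B\<close> are disjoint and \<open>p\<close> is a point of \<open>A\<close>, the map that fixes \<open>A\<close> and sends \<open>B\<close> to \<open>p\<close>
  agrees with the identity on \<open>A\<close> and with the constant map \<open>p\<close> on \<open>B\<close>; hence the constant map \<open>p\<close> of \<open>E\<close>
  fixes \<open>e\<close>. So does the constant map \<open>q\<close> for \<open>q\<close> in \<open>B\<close>. Both factor through the one-point space, so
  the image \<open>c\<close> of \<open>e\<close> in \<open>F 1\<close> satisfies \<open>F p c = e = F q c\<close>. The map from \<open>E\<close> to \<open>2\<close> that separates
  \<open>A\<close> from \<open>B\<close> turns this into the equation that defines the modification at the empty space, and so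
  \<open>a\<close> is carried by the empty set there (lemma \<open>disjoint_carriers\<close>).
\<close>

section \<open>Carriers of an element\<close>

definition carries :: "('a, 'b) spacefun \<Rightarrow> 'a set \<Rightarrow> 'a topology \<Rightarrow> 'b \<Rightarrow> bool" where
  "carries F A X a \<longleftrightarrow>
     a \<in> FMap F (discrete_topology A) X (\<lambda>x\<in>A. x) ` topspace (FOb F (discrete_topology A))"

locale mono_space_functor =
  fixes C :: "'a spacecat" and F :: "('a, 'b) spacefun"
  assumes topcat: "topological_category C"
    and functor_F: "is_functor C all_maps_cat F"
    and mono_F: "monomorphic C all_maps_cat F"
begin

lemma Hom_subset_maps: "X \<in> Ob C \<Longrightarrow> Y \<in> Ob C \<Longrightarrow> Hom C X Y \<subseteq> maps X Y"
  using topcat by (simp add: topological_category_def subcategory_def all_maps_cat_def)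

lemma Ob_discrete: "finite D \<Longrightarrow> discrete_topology D \<in> Ob C"
  using topcat by (simp add: topological_category_def)

lemma Hom_discrete:
  "finite D \<Longrightarrow> X \<in> Ob C \<Longrightarrow> f \<in> D \<rightarrow>\<^sub>E topspace X \<Longrightarrow> f \<in> Hom C (discrete_topology D) X"
  using topcat unfolding topological_category_def maps_def
  by (metis subsetD topspace_discrete_topology)

lemma Hom_inclusion:
  "finite A \<Longrightarrow> X \<in> Ob C \<Longrightarrow> A \<subseteq> topspace X \<Longrightarrow> (\<lambda>x\<in>A. x) \<in> Hom C (discrete_topology A) X"
  by (rule Hom_discrete) auto

lemma FMap_in:
  assumes "X \<in> Ob C" "Y \<in> Ob C" "f \<in> Hom C X Y" "a \<in> topspace (FOb F X)"
  shows "FMap F X Y f a \<in> topspace (FOb F Y)"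
proof -
  have "FMap F X Y f \<in> maps (FOb F X) (FOb F Y)"
    using functor_F assms by (simp add: is_functor_def all_maps_cat_def)
  then show ?thesis using assms(4) by (auto simp: maps_def)
qed

lemma FMap_id: "X \<in> Ob C \<Longrightarrow> a \<in> topspace (FOb F X) \<Longrightarrow> FMap F X X (id_map X) a = a"
  using functor_F by (simp add: is_functor_def id_map_def)

lemma FMap_compose:
  assumes "X \<in> Ob C" "Y \<in> Ob C" "Z \<in> Ob C" "f \<in> Hom C X Y" "g \<in> Hom C Y Z"
    and "a \<in> topspace (FOb F X)"
  shows "FMap F Y Z g (FMap F X Y f a) = FMap F X Z (compose (topspace X) g f) a"
proof -
  have "FMap F X Z (compose (topspace X) g f) =
      compose (topspace (FOb F X)) (FMap F Y Z g) (FMap F X Y f)"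
    using functor_F assms(1-5) unfolding is_functor_def by blast
  then show ?thesis using assms(6) by (simp add: compose_eq)
qed

lemma FMap_inclusion_inj:
  assumes "finite E" "X \<in> Ob C" "E \<subseteq> topspace X"
  shows "inj_on (FMap F (discrete_topology E) X (\<lambda>x\<in>E. x)) (topspace (FOb F (discrete_topology E)))"
proof -
  let ?E = "discrete_topology E" and ?i = "\<lambda>x\<in>E. x"
  have "monomorphism C ?E X ?i"
    unfolding monomorphism_def
  proof (intro conjI ballI impI)
    fix Z g h assume Z: "Z \<in> Ob C" and gh: "g \<in> Hom C Z ?E" "h \<in> Hom C Z ?E"
      and eq: "compose (topspace Z) ?i g = compose (topspace Z) ?i h"
    have m: "g \<in> topspace Z \<rightarrow>\<^sub>E E" "h \<in> topspace Z \<rightarrow>\<^sub>E E"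
      using Hom_subset_maps[OF Z Ob_discrete[OF assms(1)]] gh by (auto simp: maps_def)
    show "g = h"
    proof (rule PiE_ext[OF m])
      fix z assume "z \<in> topspace Z"
      then show "g z = h z" using fun_cong[OF eq, of z] m[THEN PiE_mem]
        by (simp add: compose_eq)
    qed
  qed (use assms in \<open>auto intro: Ob_discrete Hom_inclusion\<close>)
  then have mono: "monomorphism all_maps_cat (FOb F ?E) (FOb F X) (FMap F ?E X ?i)"
    using mono_F by (simp add: monomorphic_def)
  then have inj: "\<forall>Z::'b topology. \<forall>g\<in>maps Z (FOb F ?E). \<forall>h\<in>maps Z (FOb F ?E).
      compose (topspace Z) (FMap F ?E X ?i) g = compose (topspace Z) (FMap F ?E X ?i) h \<longrightarrow> g = h"
    by (simp add: monomorphism_def all_maps_cat_def)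
  show ?thesis
  proof (rule inj_onI)
    fix b c assume bc: "b \<in> topspace (FOb F ?E)" "c \<in> topspace (FOb F ?E)"
      and eq: "FMap F ?E X ?i b = FMap F ?E X ?i c"
    \<comment> \<open>Points of a space are maps from a one-point space, here the one on \<open>b\<close>.\<close>
    let ?Z = "discrete_topology {b}"
    have "(\<lambda>z\<in>{b}. b) \<in> maps ?Z (FOb F ?E)" "(\<lambda>z\<in>{b}. c) \<in> maps ?Z (FOb F ?E)"
      using bc by (auto simp: maps_def)
    moreover have "compose (topspace ?Z) (FMap F ?E X ?i) (\<lambda>z\<in>{b}. b) =
        compose (topspace ?Z) (FMap F ?E X ?i) (\<lambda>z\<in>{b}. c)"
      using eq by (auto simp: compose_def)
    ultimately have "(\<lambda>z\<in>{b}. b) = (\<lambda>z\<in>{b}. c)"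
      using inj[THEN spec, of ?Z] by blast
    then show "b = c" by (metis restrict_apply' singletonI)
  qed
qed

lemma carries_in:
  assumes "finite A" "X \<in> Ob C" "A \<subseteq> topspace X" "carries F A X a"
  shows "a \<in> topspace (FOb F X)"
  using assms FMap_in[OF Ob_discrete _ Hom_inclusion] by (auto simp: carries_def)

text \<open>
  If \<open>a\<close> comes from \<open>F A\<close>, then \<open>F u\<close> acts on \<open>a\<close> through the composite of \<open>u\<close> with the inclusion of \<open>A\<close>,
  which sees only the restriction of \<open>u\<close>.
\<close>

lemma FMap_cong_on_carrier:
  assumes "finite A" "X \<in> Ob C" "A \<subseteq> topspace X" "carries F A X a" "Y \<in> Ob C"
    and "u \<in> Hom C X Y" "v \<in> Hom C X Y" and eq: "\<And>x. x \<in> A \<Longrightarrow> u x = v x"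
  shows "FMap F X Y u a = FMap F X Y v a"
proof -
  have "compose A u (\<lambda>x\<in>A. x) = compose A v (\<lambda>x\<in>A. x)"
    using eq by (auto simp: compose_def)
  then show ?thesis
    using assms by (auto simp: carries_def FMap_compose Ob_discrete Hom_inclusion)
qed

lemma carries_image:
  assumes "finite B" "X \<in> Ob C" "B \<subseteq> topspace X" "carries F B X a" "Y \<in> Ob C"
    and u: "u \<in> Hom C X Y" and D: "finite D" "u ` B \<subseteq> D" "D \<subseteq> topspace Y"
  shows "carries F D Y (FMap F X Y u a)"
proof -
  let ?B = "discrete_topology B" and ?D = "discrete_topology D"
  obtain b where b: "b \<in> topspace (FOb F ?B)" "a = FMap F ?B X (\<lambda>x\<in>B. x) b"
    using assms(4) by (auto simp: carries_def)
  have u': "(\<lambda>x\<in>B. u x) \<in> Hom C ?B ?D"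
    using assms by (auto intro!: Hom_discrete Ob_discrete)
  have "FMap F X Y u a = FMap F ?B Y (compose B u (\<lambda>x\<in>B. x)) b"
    using assms b by (simp add: FMap_compose Ob_discrete Hom_inclusion)
  also have "compose B u (\<lambda>x\<in>B. x) = compose B (\<lambda>x\<in>D. x) (\<lambda>x\<in>B. u x)"
    using D by (auto simp: compose_def fun_eq_iff)
  also have "FMap F ?B Y \<dots> b = FMap F ?D Y (\<lambda>x\<in>D. x) (FMap F ?B ?D (\<lambda>x\<in>B. u x) b)"
    using assms b u' by (simp add: FMap_compose Ob_discrete Hom_inclusion)
  finally show ?thesis
    using FMap_in[OF Ob_discrete Ob_discrete u' b(1)] assms(1) D(1) by (auto simp: carries_def)
qed

text \<open>
  The lifts of \<open>a\<close> along \<open>A\<close> and along \<open>B\<close> are the same element of \<open>F (A \<union> B)\<close> since \<open>F\<close> of the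
  inclusion of \<open>A \<union> B\<close> is injective; this is the only use of monomorphicity.
\<close>

lemma lift_to_union:
  assumes "finite A" "finite B" "X \<in> Ob C" "A \<subseteq> topspace X" "B \<subseteq> topspace X"
    and "carries F A X a" "carries F B X a"
  defines "E \<equiv> discrete_topology (A \<union> B)"
  obtains e where "carries F A E e" "carries F B E e" "a = FMap F E X (\<lambda>x\<in>A \<union> B. x) e"
proof -
  have E: "E \<in> Ob C" "topspace E = A \<union> B" using assms by (auto simp: E_def intro: Ob_discrete)
  have i: "(\<lambda>x\<in>A \<union> B. x) \<in> Hom C E X"
    unfolding E_def using assms by (intro Hom_inclusion) auto
  have lift: "\<exists>e. carries F D E e \<and> a = FMap F E X (\<lambda>x\<in>A \<union> B. x) e"
    if D: "finite D" "D \<subseteq> A \<union> B" "carries F D X a" for D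
  proof -
    let ?D = "discrete_topology D"
    obtain b where b: "b \<in> topspace (FOb F ?D)" "a = FMap F ?D X (\<lambda>x\<in>D. x) b"
      using D(3) by (auto simp: carries_def)
    have "compose D (\<lambda>x\<in>A \<union> B. x) (\<lambda>x\<in>D. x) = (\<lambda>x\<in>D. x)"
      using D by (auto simp: compose_def fun_eq_iff)
    then have "FMap F E X (\<lambda>x\<in>A \<union> B. x) (FMap F ?D E (\<lambda>x\<in>D. x) b) = a"
      using D E i b assms by (simp add: FMap_compose Ob_discrete Hom_inclusion)
    then show ?thesis using b(1) by (auto simp: carries_def)
  qed
  obtain e where e: "carries F A E e" "a = FMap F E X (\<lambda>x\<in>A \<union> B. x) e"
    using lift[of A] assms by auto
  obtain e' where e': "carries F B E e'" "a = FMap F E X (\<lambda>x\<in>A \<union> B. x) e'"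
    using lift[of B] assms by auto
  have "e \<in> topspace (FOb F E)" "e' \<in> topspace (FOb F E)"
    using carries_in[OF _ E(1)] e e' E assms by auto
  then have "e = e'"
    using FMap_inclusion_inj[of "A \<union> B" X] e e' assms by (auto simp: E_def dest: inj_onD)
  then show ?thesis using that e e' by blast
qed

section \<open>Intersections of carriers\<close>

lemma carrier_Int:
  assumes "finite A" "finite B" "X \<in> Ob C" "A \<subseteq> topspace X" "B \<subseteq> topspace X"
    and "carries F A X a" "carries F B X a" and ne: "A \<inter> B \<noteq> {}"
  shows "carries F (A \<inter> B) X a"
proof -
  let ?E = "discrete_topology (A \<union> B)"
  have E: "?E \<in> Ob C" using assms by (auto intro: Ob_discrete)
  obtain e where e: "carries F A ?E e" "carries F B ?E e" "a = FMap F ?E X (\<lambda>x\<in>A \<union> B. x) e"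
    using lift_to_union assms by metis
  obtain d where d: "d \<in> A \<inter> B" using ne by blast
  define u where "u = (\<lambda>x\<in>A \<union> B. if x \<in> A then x else d)"
  have u: "u \<in> Hom C ?E ?E" and i: "id_map ?E \<in> Hom C ?E ?E"
    using assms d E by (auto simp: u_def id_map_def intro!: Hom_discrete split: if_splits)
  have "FMap F ?E ?E u e = FMap F ?E ?E (id_map ?E) e"
    using assms by (intro FMap_cong_on_carrier[OF _ E _ e(1) E u i]) (auto simp: u_def id_map_def)
  also have "\<dots> = e"
    using carries_in[OF assms(1) E _ e(1)] by (simp add: FMap_id E)
  finally have "FMap F ?E ?E u e = e" .
  moreover have "carries F (A \<inter> B) ?E (FMap F ?E ?E u e)"
    using assms d by (intro carries_image[OF _ E _ e(2) E u]) (auto simp: u_def)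
  ultimately have "carries F (A \<inter> B) ?E e" by simp
  then show ?thesis
    unfolding e(3) using assms
    by (intro carries_image[OF _ E _ _ _ Hom_inclusion]) auto
qed

text \<open>
  The witness \<open>c\<close> is the image of \<open>e\<close> under the map to the one-point space. Applying \<open>F\<close> to the map
  of \<open>A \<union> B\<close> to \<open>2\<close> with the fibres \<open>A\<close> and \<open>B\<close> shows that both points of \<open>2\<close> send \<open>c\<close> to the same
  element.
\<close>

lemma disjoint_carriers:
  assumes "inj \<nu>" "finite A" "finite B" "X \<in> Ob C" "A \<subseteq> topspace X" "B \<subseteq> topspace X"
    and "carries F A X a" "carries F B X a"
    and disj: "A \<inter> B = {}" and ne: "A \<noteq> {}" "B \<noteq> {}"
  shows "\<exists>c\<in>circ_empty \<nu> F. \<exists>g\<in>maps (ordinal_space \<nu> 1) X. a = FMap F (ordinal_space \<nu> 1) X g c"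
proof -
  let ?E = "discrete_topology (A \<union> B)" and ?P = "ordinal_space \<nu> 1" and ?Q = "ordinal_space \<nu> 2"
  have P: "?P = discrete_topology {\<nu> 0}" and Q: "?Q = discrete_topology {\<nu> 0, \<nu> 1}"
    by (simp_all add: ordinal_space_def lessThan_Suc numeral_2_eq_2 insert_commute)
  have E: "?E \<in> Ob C" using assms by (auto intro: Ob_discrete)
  have PC: "?P \<in> Ob C" and QC: "?Q \<in> Ob C" unfolding P Q by (simp_all add: Ob_discrete)
  obtain e where e: "carries F A ?E e" "carries F B ?E e" "a = FMap F ?E X (\<lambda>x\<in>A \<union> B. x) e"
    using lift_to_union assms by metis
  have eE: "e \<in> topspace (FOb F ?E)"
    using carries_in[OF assms(2) E _ e(1)] by simp
  have const_fixes: "FMap F ?E ?E (\<lambda>x\<in>A \<union> B. p) e = e"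
    if S: "carries F S ?E e" "carries F T ?E e" "p \<in> S" "S \<inter> T = {}" "S \<union> T = A \<union> B" for S T p
  proof -
    define u where "u = (\<lambda>x\<in>A \<union> B. if x \<in> S then x else p)"
    have fin: "finite S" "finite T" using S(5) assms(2,3) by (metis finite_Un)+
    have h: "u \<in> Hom C ?E ?E" "id_map ?E \<in> Hom C ?E ?E" "(\<lambda>x\<in>A \<union> B. p) \<in> Hom C ?E ?E"
      using assms S E
      by (auto simp: u_def id_map_def intro!: Hom_discrete split: if_splits)
    have "FMap F ?E ?E (\<lambda>x\<in>A \<union> B. p) e = FMap F ?E ?E u e"
      using S by (intro FMap_cong_on_carrier[OF fin(2) E _ S(2) E h(3,1)]) (auto simp: u_def)
    also have "\<dots> = FMap F ?E ?E (id_map ?E) e"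
      using S by (intro FMap_cong_on_carrier[OF fin(1) E _ S(1) E h(1,2)])
        (auto simp: u_def id_map_def)
    also have "\<dots> = e" by (rule FMap_id[OF E eE])
    finally show ?thesis .
  qed
  obtain p q where p: "p \<in> A" and q: "q \<in> B" using ne by blast
  define t where "t = (\<lambda>x\<in>A \<union> B. \<nu> 0)"
  define c where "c = FMap F ?E ?P t e"
  define h where "h = (\<lambda>x\<in>A \<union> B. if x \<in> A then \<nu> 0 else \<nu> 1)"
  have t: "t \<in> Hom C ?E ?P"
    unfolding t_def using assms PC by (intro Hom_discrete) (auto simp: P simp del: One_nat_def)
  have h: "h \<in> Hom C ?E ?Q"
    unfolding h_def using assms QC by (intro Hom_discrete) (auto simp: Q)
  have c: "c \<in> topspace (FOb F ?P)" unfolding c_def by (rule FMap_in[OF E PC t eE])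
  have pt: "(\<lambda>x\<in>{\<nu> 0}. r) \<in> Hom C ?P ?E" if "r \<in> A \<union> B" for r
    unfolding P using E that by (intro Hom_discrete) auto
  have pt_c: "FMap F ?P ?E (\<lambda>x\<in>{\<nu> 0}. r) c = FMap F ?E ?E (\<lambda>x\<in>A \<union> B. r) e"
    if "r \<in> A \<union> B" for r
  proof -
    have "compose (topspace ?E) (\<lambda>x\<in>{\<nu> 0}. r) t = (\<lambda>x\<in>A \<union> B. r)"
      by (auto simp: t_def compose_def fun_eq_iff)
    then show ?thesis
      unfolding c_def using FMap_compose[OF E PC E t pt[OF that] eE] by simp
  qed
  have pc: "FMap F ?P ?E (\<lambda>x\<in>{\<nu> 0}. p) c = e"
    using pt_c[of p] const_fixes[OF e(1,2) p] p disj by simp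
  have qc: "FMap F ?P ?E (\<lambda>x\<in>{\<nu> 0}. q) c = e"
    using pt_c[of q] const_fixes[OF e(2,1) q] q disj by (simp add: Int_commute Un_commute)
  have "compose (topspace ?P) h (\<lambda>x\<in>{\<nu> 0}. p) = const_1_2 \<nu> 0"
    "compose (topspace ?P) h (\<lambda>x\<in>{\<nu> 0}. q) = const_1_2 \<nu> 1"
    using p q disj by (auto simp: P h_def const_1_2_def compose_def fun_eq_iff simp del: One_nat_def)
  then have "FMap F ?P ?Q (const_1_2 \<nu> 0) c = FMap F ?E ?Q h e"
    "FMap F ?P ?Q (const_1_2 \<nu> 1) c = FMap F ?E ?Q h e"
    using FMap_compose[OF PC E QC pt[of p] h c] FMap_compose[OF PC E QC pt[of q] h c] pc qc p q
    by auto
  then have "c \<in> circ_empty \<nu> F" using c by (simp add: circ_empty_def)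
  moreover have "a = FMap F ?P X (compose (topspace ?P) (\<lambda>x\<in>A \<union> B. x) (\<lambda>x\<in>{\<nu> 0}. p)) c"
    using FMap_compose[OF PC E assms(4) pt[of p] Hom_inclusion c] assms pc e(3) p by simp
  moreover have "compose (topspace ?P) (\<lambda>x\<in>A \<union> B. x) (\<lambda>x\<in>{\<nu> 0}. p) \<in> maps ?P X"
    using p assms by (auto simp: P maps_def compose_def simp del: One_nat_def)
  ultimately show ?thesis by blast
qed

section \<open>Supporting sets\<close>

lemma supporting_sets_nonempty_iff:
  assumes "A \<noteq> {}"
  shows "A \<in> supporting_sets \<nu> F X a \<longleftrightarrow> finite A \<and> A \<subseteq> topspace X \<and> carries F A X a"
proof -
  have ne: "topspace (discrete_topology A) \<noteq> {}" using assms by simp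
  show ?thesis
    unfolding supporting_sets_def carries_def circ_def spacefun.simps mem_Collect_eq if_P[OF ne] ..
qed

lemma topspace_circ_empty:
  "topspace (FOb (circ \<nu> F) (discrete_topology {})) = circ_empty \<nu> F"
  by (auto simp: circ_def circ_empty_def simp del: One_nat_def)

lemma empty_in_supporting_sets:
  assumes "inj \<nu>" "X \<in> Ob C" "topspace X \<noteq> {}" "c \<in> circ_empty \<nu> F"
    and g: "g \<in> maps (ordinal_space \<nu> 1) X" and a: "a = FMap F (ordinal_space \<nu> 1) X g c"
  shows "{} \<in> supporting_sets \<nu> F X a"
proof -
  let ?g = "SOME g. g \<in> maps (ordinal_space \<nu> 1) X"
  have "?g \<in> maps (ordinal_space \<nu> 1) X"
    using g by (rule someI[of "\<lambda>g. g \<in> maps (ordinal_space \<nu> 1) X"])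
  then have "a = FMap F (ordinal_space \<nu> 1) X ?g c"
    unfolding a by (rule circ_empty_eq[OF topcat functor_F assms(1,2,4) g])
  also have "\<dots> = FMap (circ \<nu> F) (discrete_topology {}) X (\<lambda>x\<in>{}. x) c"
    using assms(3,4) by (simp add: circ_def)
  finally have "a \<in> FMap (circ \<nu> F) (discrete_topology {}) X (\<lambda>x\<in>{}. x) ` circ_empty \<nu> F"
    using assms(4) by (rule image_eqI)
  then show ?thesis by (simp only: supporting_sets_def topspace_circ_empty mem_Collect_eq
      finite.emptyI empty_subsetI simp_thms)
qed

lemma supporting_sets_Int:
  assumes "inj \<nu>" "X \<in> Ob C"
    and A: "A \<in> supporting_sets \<nu> F X a" and B: "B \<in> supporting_sets \<nu> F X a"
  shows "A \<inter> B \<in> supporting_sets \<nu> F X a"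
proof (cases "A = {} \<or> B = {}")
  case True
  then show ?thesis using A B by auto
next
  case False
  then have ne: "A \<noteq> {}" "B \<noteq> {}" by auto
  have fA: "finite A" "A \<subseteq> topspace X" "carries F A X a"
    and fB: "finite B" "B \<subseteq> topspace X" "carries F B X a"
    using A B ne by (auto simp: supporting_sets_nonempty_iff)
  show ?thesis
  proof (cases "A \<inter> B = {}")
    case True
    obtain c g where cg: "c \<in> circ_empty \<nu> F" "g \<in> maps (ordinal_space \<nu> 1) X"
      "a = FMap F (ordinal_space \<nu> 1) X g c"
      using disjoint_carriers[OF assms(1) fA(1) fB(1) assms(2) fA(2) fB(2) fA(3) fB(3) True ne]
      by (elim bexE)
    have "topspace X \<noteq> {}" using ne fA by blast
    then show ?thesis
      unfolding True by (rule empty_in_supporting_sets[OF assms(1,2) _ cg])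
  next
    case False
    then show ?thesis
      using carrier_Int[OF fA(1) fB(1) assms(2) fA(2) fB(2) fA(3) fB(3)] fA fB
      by (auto simp: supporting_sets_nonempty_iff)
  qed
qed

text \<open>
  If \<open>a\<close> lies in the image of \<open>F f\<close> then it is carried by the set of values of \<open>f\<close>, and by every larger
  finite set. Adding a point \<open>x\<close> makes that set non-empty, and there the modified functor agrees
  with \<open>F\<close>.
\<close>

lemma supporting_sets_nonempty:
  assumes "finite_supports C F" "X \<in> Ob C" "a \<in> topspace (FOb (circ \<nu> F) X)"
  shows "supporting_sets \<nu> F X a \<noteq> {}"
proof (cases "topspace X = {}")
  case True
  then have X: "X = discrete_topology {}" by simp
  have "a \<in> circ_empty \<nu> F" using assms(3) unfolding X topspace_circ_empty .
  then have "{} \<in> supporting_sets \<nu> F X a"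
    unfolding supporting_sets_def X topspace_circ_empty
    by (auto simp: circ_def circ_empty_def simp del: One_nat_def)
  then show ?thesis by blast
next
  case False
  then obtain x where x: "x \<in> topspace X" by blast
  have "a \<in> topspace (FOb F X)" using assms(3) False by (simp add: circ_def)
  then obtain A f b where A: "finite A" and f: "f \<in> maps (discrete_topology A) X"
    and b: "b \<in> topspace (FOb F (discrete_topology A))"
    and a: "a = FMap F (discrete_topology A) X f b"
    using assms(1,2) unfolding finite_supports_def by blast
  let ?A = "discrete_topology A"
  have fh: "f \<in> Hom C ?A X" using f A assms(2) by (auto simp: maps_def intro: Hom_discrete)
  have "b = FMap F ?A ?A (\<lambda>x\<in>A. x) b"
    using FMap_id[OF Ob_discrete[OF A] b] by (simp add: id_map_def)
  then have "carries F A ?A b" using b by (auto simp: carries_def)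
  then have "carries F (insert x (f ` A)) X a"
    unfolding a using A f x assms(2)
    by (intro carries_image[OF A Ob_discrete[OF A] _ _ _ fh]) (auto simp: maps_def)
  then have "insert x (f ` A) \<in> supporting_sets \<nu> F X a"
    using A f x by (auto simp: supporting_sets_nonempty_iff maps_def)
  then show ?thesis by blast
qed

end

lemma Inter_mem_if_Int_closed:
  assumes ne: "\<A> \<noteq> {}" and fin: "\<And>A. A \<in> \<A> \<Longrightarrow> finite A"
    and Int: "\<And>A B. A \<in> \<A> \<Longrightarrow> B \<in> \<A> \<Longrightarrow> A \<inter> B \<in> \<A>"
  shows "\<Inter>\<A> \<in> \<A>"
proof -
  obtain A where A: "A \<in> \<A>" and least: "\<And>B. B \<in> \<A> \<Longrightarrow> card A \<le> card B"
    using ne ex_has_least_nat[of "\<lambda>A. A \<in> \<A>" _ card] by blast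
  have "A \<subseteq> B" if "B \<in> \<A>" for B
  proof -
    have "A \<inter> B = A" by (rule card_seteq) (use fin A least Int that in auto)
    then show ?thesis by blast
  qed
  then have "\<Inter>\<A> = A" using A by blast
  then show ?thesis using A by simp
qed

theorem theorem2:
  fixes C :: "'a spacecat" and F :: "('a, 'b) spacefun" and \<nu> :: "nat \<Rightarrow> 'a"
    and X :: "'a topology" and a :: 'b
  assumes "inj \<nu>"
    and "topological_category C"
    and "is_functor C all_maps_cat F"
    and "monomorphic C all_maps_cat F"
    and "finite_supports C F"
    and "X \<in> Ob C"
    and "a \<in> topspace (FOb (circ \<nu> F) X)"
  shows "supporting_sets \<nu> F X a \<noteq> {} \<and>
    finite (supp \<nu> F X a) \<and> supp \<nu> F X a \<subseteq> topspace X \<and>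
    a \<in> FMap (circ \<nu> F) (discrete_topology (supp \<nu> F X a)) X (\<lambda>x\<in>supp \<nu> F X a. x) `
          topspace (FOb (circ \<nu> F) (discrete_topology (supp \<nu> F X a)))"
proof -
  interpret mono_space_functor C F by unfold_locales (fact assms)+
  have ne: "supporting_sets \<nu> F X a \<noteq> {}"
    by (rule supporting_sets_nonempty) (fact assms)+
  have "supp \<nu> F X a \<in> supporting_sets \<nu> F X a"
    unfolding supp_def
  proof (rule Inter_mem_if_Int_closed[OF ne])
    show "finite A" if "A \<in> supporting_sets \<nu> F X a" for A
      using that by (simp add: supporting_sets_def)
  qed (rule supporting_sets_Int[OF assms(1,6)])
  then show ?thesis using ne by (simp add: supporting_sets_def)
qed

end
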